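(* Let $\mathcal K$ be a tame topological Kuranishi atlas with a reduction $\mathcal V=\bigsqcup_I V_I$ and a nested reduction $\mathcal C\sqsubset\mathcal V$. Let $\sigma=(\sigma_I:V_I\to\mathbb E_I)_{I\in\mathcal I_{\mathcal K}}$ be a family of continuous maps with $\mathrm{pr}_I\circ\sigma_I=\mathrm{id}_{V_I}$ (for instance $\sigma_I=\mathfrak s_I|_{V_I}+\nu_I$ for a compatible perturbation $\nu_I$ when the fibres carry a continuous addition) such that $$\widehat\Phi_{IJ}\circ\sigma_I=\sigma_J\circ\phi_{IJ}\ \text{ on } V_I\cap U_{IJ}\cap\phi_{IJ}^{-1}(V_J)\quad\text{for all } I\subsetneq J,$$ $$\sigma_I^{-1}(0_I):=\{x\in V_I:\sigma_I(x)=0_I(x)\}\subset\pi_{\mathcal K}^{-1}(\pi_{\mathcal K}(\mathcal C))\cap V_I\quad\text{for all } I.$$ Let $\mathcal Z:=\bigsqcup_I\{I\}\times\sigma_I^{-1}(0_I)$ and let $|\mathcal Z|$ be its quotient by the equivalence relation generated by $(I,x)\sim(J,\phi_{IJ}(x))$ whenever $I\subset J$, $x\in U_{IJ}$, and both $(I,x)$ and $(J,\phi_{IJ}(x))$ lie in $\mathcal Z$, equipped with the quotient topology. Then $|\mathcal Z|$ is a sequentially compact Hausdorff space.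
   Context: Notation: for subsets $V'\subset V$ of a topological space, $V'\sqsubset V$ means the closure of $V'$ in $V$ is compact. $X$ is a compact metrizable space. Charts: a topological Kuranishi chart for $X$ with open footprint $F\subset X$ is a tuple $\mathbf K=(U,\mathbb E,\mathfrak s,\psi)$ where $U$ is a separable, locally compact, metrizable space; $\mathbb E$ is a separable, locally compact, metrizable space with continuous maps $\mathrm{pr}:\mathbb E\to U$ and $0:U\to\mathbb E$ with $\mathrm{pr}\circ0=\mathrm{id}_U$; $\mathfrak s:U\to\mathbb E$ is continuous with $\mathrm{pr}\circ\mathfrak s=\mathrm{id}_U$; and $\psi$ is a homeomorphism from $\mathfrak s^{-1}(0):=\{x\in U:\mathfrak s(x)=0(x)\}$ onto $F$. Coordinate changes: for charts $\mathbf K_I,\mathbf K_J$ with $F_I\cap F_J\neq\emptyset$, a coordinate change $\widehat\Phi_{IJ}:\mathbf K_I\to\mathbf K_J$ consists of an open set $U_{IJ}\subset U_I$ with $U_{IJ}\cap\mathfrak s_I^{-1}(0_I)=\psi_I^{-1}(F_I\cap F_J)$ and a topological embedding $\widehat\Phi_{IJ}:\mathrm{pr}_I^{-1}(U_{IJ})\to\mathbb E_J$ such that there is a topological embedding $\phi_{IJ}:U_{IJ}\to U_J$ with $\mathrm{pr}_J\circ\widehat\Phi_{IJ}=\phi_{IJ}\circ\mathrm{pr}_I$, $0_J\circ\phi_{IJ}=\widehat\Phi_{IJ}\circ0_I$ and $\mathfrak s_J\circ\phi_{IJ}=\widehat\Phi_{IJ}\circ\mathfrak s_I$ on $U_{IJ}$,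 and $\phi_{IJ}=\psi_J^{-1}\circ\psi_I$ on $U_{IJ}\cap\mathfrak s_I^{-1}(0_I)$. Atlases: a covering family of basic charts is a finite family $(\mathbf K_i)_{i=1,\dots,N}$ of charts whose footprints cover $X$; $\mathcal I_{\mathcal K}$ is the set of nonempty $I\subset\{1,\dots,N\}$ with $F_I:=\bigcap_{i\in I}F_i\neq\emptyset$. Transition data consist of a chart $\mathbf K_J$ with footprint $F_J$ for each $J\in\mathcal I_{\mathcal K}$ with $|J|\ge2$ (and $\mathbf K_{\{i\}}:=\mathbf K_i$), and a coordinate change $\widehat\Phi_{IJ}:\mathbf K_I\to\mathbf K_J$ for all $I\subsetneq J$ in $\mathcal I_{\mathcal K}$. We set $U_{II}:=U_I$, $\phi_{II}:=\mathrm{id}_{U_I}$. For $I\subsetneq J\subsetneq K$ let $U_{IJK}:=U_{IJ}\cap\phi_{IJ}^{-1}(U_{JK})$. The triple satisfies the weak cocycle condition if $\widehat\Phi_{JK}\circ\widehat\Phi_{IJ}=\widehat\Phi_{IK}$ on $\mathrm{pr}_I^{-1}(U_{IJK}\cap U_{IK})$; the cocycle condition if in addition $U_{IJK}\subset U_{IK}$; the strong cocycle condition if in addition $U_{IJK}=U_{IK}$. A weak topological Kuranishi atlas $\mathcal K$ is a covering family with transition data satisfying the weak cocycle condition for all such triples; a topological Kuranishi atlas is one satisfying the cocycle condition for all triples. Filtrations: a weak topological Kuranishi atlas is filtered if it is equipped with closed subsets $\mathbb E_{IJ}\subset\mathbb E_J$ for all $J\in\mathcal I_{\mathcal K}$ and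 $I\subset J$ (including $I=\emptyset$) such that (i) $\mathbb E_{JJ}=\mathbb E_J$ and $\mathbb E_{\emptyset J}=\mathrm{im}\,0_J$; (ii) $\widehat\Phi_{JK}(\mathrm{pr}_J^{-1}(U_{JK})\cap\mathbb E_{IJ})=\mathbb E_{IK}\cap\mathrm{pr}_K^{-1}(\mathrm{im}\,\phi_{JK})$ for $I\subset J\subsetneq K$; (iii) $\mathbb E_{IJ}\cap\mathbb E_{HJ}=\mathbb E_{(I\cap H)J}$ for $I,H\subset J$; (iv) $\mathrm{im}\,\phi_{IJ}$ is an open subset of $\mathfrak s_J^{-1}(\mathbb E_{IJ})$ for $I\subsetneq J$. Tameness: a filtered weak topological Kuranishi atlas is tame if $U_{IJ}\cap U_{IK}=U_{I(J\cup K)}$ for all $I,J,K\in\mathcal I_{\mathcal K}$ with $I\subset J,K$ (where $U_{IL}:=\emptyset$ if $L\notin\mathcal I_{\mathcal K}$), and $\phi_{IJ}(U_{IK})=U_{JK}\cap\mathfrak s_J^{-1}(\mathbb E_{IJ})$ for all $I\subset J\subset K$ in $\mathcal I_{\mathcal K}$ (equalities of indices allowed). Virtual neighbourhood: for a topological Kuranishi atlas, $|\mathcal K|$ is the quotient of $\bigsqcup_{I\in\mathcal I_{\mathcal K}}U_I=\{(I,x):x\in U_I\}$ by the equivalence relation generated by $(I,x)\sim(J,\phi_{IJ}(x))$ for $I\subset J$, $x\in U_{IJ}$, with the quotient topology and projection $\pi_{\mathcal K}$; $\iota_{\mathcal K}(X):=\pi_{\mathcal K}\big(\bigsqcup_I\{I\}\times\mathfrak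 s_I^{-1}(0_I)\big)\subset|\mathcal K|$. Reductions: a reduction of a tame topological Kuranishi atlas $\mathcal K$ is a tuple $\mathcal V=\bigsqcup_{I\in\mathcal I_{\mathcal K}}V_I$ of (possibly empty) open subsets $V_I\subset U_I$ such that (i) $V_I\sqsubset U_I$ for all $I$, and $V_I\neq\emptyset$ implies $V_I\cap\mathfrak s_I^{-1}(0_I)\neq\emptyset$; (ii) if $\pi_{\mathcal K}(\overline{V_I})\cap\pi_{\mathcal K}(\overline{V_J})\neq\emptyset$ (closures in $U_I$, $U_J$) then $I\subset J$ or $J\subset I$; (iii) $\iota_{\mathcal K}(X)\subset\pi_{\mathcal K}(\mathcal V)=\bigcup_I\pi_{\mathcal K}(V_I)$. A nested reduction is a pair of reductions $\mathcal C\sqsubset\mathcal V$, meaning $C_I\sqsubset V_I$ for all $I$. *)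

theory Defs
  imports "HOL-Analysis.Analysis"
begin

section \<open>Topological Kuranishi atlases (data)\<close>

text \<open>All charts of an atlas live in common ambient types: points of the domains
U_I have type 'u, points of the obstruction spaces E_I have type 'e, and X has type 'x.
Index sets I are finite sets of natural numbers; the basic charts are indexed by
the singletons {i}, i = 1..N. The map phi of a coordinate change is carried as
data (it is uniquely determined by Phi).\<close>

record ('x, 'u, 'e) kur_data =
  nb   :: nat                                  \<comment> \<open>N, number of basic charts\<close>
  UT   :: "nat set \<Rightarrow> 'u topology"           \<comment> \<open>domain U_I\<close>
  ET   :: "nat set \<Rightarrow> 'e topology"           \<comment> \<open>obstruction bundle E_I\<close>
  prj  :: "nat set \<Rightarrow> 'e \<Rightarrow> 'u"            \<comment> \<open>pr_I\<close>
  zr   :: "nat set \<Rightarrow> 'u \<Rightarrow> 'e"            \<comment> \<open>zero section 0_I\<close>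
  sc   :: "nat set \<Rightarrow> 'u \<Rightarrow> 'e"            \<comment> \<open>section s_I\<close>
  psi  :: "nat set \<Rightarrow> 'u \<Rightarrow> 'x"            \<comment> \<open>footprint map psi_I\<close>
  fp   :: "nat set \<Rightarrow> 'x set"               \<comment> \<open>footprint F_I\<close>
  dom  :: "nat set \<Rightarrow> nat set \<Rightarrow> 'u set"    \<comment> \<open>U_IJ\<close>
  Phi  :: "nat set \<Rightarrow> nat set \<Rightarrow> 'e \<Rightarrow> 'e" \<comment> \<open>Phi_IJ\<close>
  phi  :: "nat set \<Rightarrow> nat set \<Rightarrow> 'u \<Rightarrow> 'u" \<comment> \<open>phi_IJ\<close>
  filt :: "nat set \<Rightarrow> nat set \<Rightarrow> 'e set"    \<comment> \<open>filtration E_IJ\<close>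

definition zero_set :: "('x,'u,'e,'z) kur_data_scheme \<Rightarrow> nat set \<Rightarrow> 'u set" where
  "zero_set K I = {x \<in> topspace (UT K I). sc K I x = zr K I x}"

definition kur_chart :: "'x topology \<Rightarrow> ('x,'u,'e,'z) kur_data_scheme \<Rightarrow> nat set \<Rightarrow> bool" where
  "kur_chart X K I \<longleftrightarrow>
     metrizable_space (UT K I) \<and> separable_space (UT K I) \<and> locally_compact_space (UT K I) \<and>
     metrizable_space (ET K I) \<and> separable_space (ET K I) \<and> locally_compact_space (ET K I) \<and>
     continuous_map (ET K I) (UT K I) (prj K I) \<and>
     continuous_map (UT K I) (ET K I) (zr K I) \<and>
     (\<forall>x \<in> topspace (UT K I). prj K I (zr K I x) = x) \<and>
     continuous_map (UT K I) (ET K I) (sc K I) \<and>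
     (\<forall>x \<in> topspace (UT K I). prj K I (sc K I x) = x) \<and>
     openin X (fp K I) \<and>
     homeomorphic_map (subtopology (UT K I) (zero_set K I)) (subtopology X (fp K I)) (psi K I)"

definition coord_change :: "('x,'u,'e,'z) kur_data_scheme \<Rightarrow> nat set \<Rightarrow> nat set \<Rightarrow> bool" where
  "coord_change K I J \<longleftrightarrow>
     openin (UT K I) (dom K I J) \<and>
     dom K I J \<inter> zero_set K I = {x \<in> zero_set K I. psi K I x \<in> fp K I \<inter> fp K J} \<and>
     embedding_map (subtopology (ET K I) {e \<in> topspace (ET K I). prj K I e \<in> dom K I J})
                   (ET K J) (Phi K I J) \<and>
     embedding_map (subtopology (UT K I) (dom K I J)) (UT K J) (phi K I J) \<and>
     (\<forall>e \<in> topspace (ET K I). prj K I e \<in> dom K I J \<longrightarrow>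
          prj K J (Phi K I J e) = phi K I J (prj K I e)) \<and>
     (\<forall>x \<in> dom K I J. zr K J (phi K I J x) = Phi K I J (zr K I x)) \<and>
     (\<forall>x \<in> dom K I J. sc K J (phi K I J x) = Phi K I J (sc K I x)) \<and>
     \<comment> \<open>phi_IJ = psi_J^{-1} o psi_I on U_IJ \<inter> s_I^{-1}(0_I)\<close>
     (\<forall>x \<in> dom K I J \<inter> zero_set K I.
          phi K I J x \<in> zero_set K J \<and> psi K J (phi K I J x) = psi K I x)"

text \<open>The index set I_K.\<close>
definition kIK :: "('x,'u,'e,'z) kur_data_scheme \<Rightarrow> nat set set" where
  "kIK K = {I. I \<noteq> {} \<and> I \<subseteq> {1..nb K} \<and> (\<Inter>i\<in>I. fp K {i}) \<noteq> {}}"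

text \<open>Conventions U_II = U_I, phi_II = id.\<close>
definition domc :: "('x,'u,'e,'z) kur_data_scheme \<Rightarrow> nat set \<Rightarrow> nat set \<Rightarrow> 'u set" where
  "domc K I J = (if I = J then topspace (UT K I) else dom K I J)"

definition phic :: "('x,'u,'e,'z) kur_data_scheme \<Rightarrow> nat set \<Rightarrow> nat set \<Rightarrow> 'u \<Rightarrow> 'u" where
  "phic K I J = (if I = J then id else phi K I J)"

definition cocycle :: "('x,'u,'e,'z) kur_data_scheme \<Rightarrow> bool" where
  "cocycle K \<longleftrightarrow>
     (\<forall>I \<in> kIK K. \<forall>J \<in> kIK K. \<forall>L \<in> kIK K. I \<subset> J \<and> J \<subset> L \<longrightarrow>
        (\<forall>e \<in> topspace (ET K I).
            prj K I e \<in> dom K I J \<inter> phi K I J -` dom K J L \<inter> dom K I L \<longrightarrow>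
            Phi K J L (Phi K I J e) = Phi K I L e) \<and>
        dom K I J \<inter> phi K I J -` dom K J L \<subseteq> dom K I L)"

text \<open>Topological Kuranishi atlas (with the cocycle condition).\<close>
definition kur_atlas :: "'x topology \<Rightarrow> ('x,'u,'e,'z) kur_data_scheme \<Rightarrow> bool" where
  "kur_atlas X K \<longleftrightarrow>
     (\<Union>i\<in>{1..nb K}. fp K {i}) = topspace X \<and>
     (\<forall>I \<in> kIK K. kur_chart X K I \<and> fp K I = (\<Inter>i\<in>I. fp K {i})) \<and>
     (\<forall>I \<in> kIK K. \<forall>J \<in> kIK K. I \<subset> J \<longrightarrow> coord_change K I J) \<and>
     cocycle K"

definition filtered :: "('x,'u,'e,'z) kur_data_scheme \<Rightarrow> bool" where
  "filtered K \<longleftrightarrow>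
     (\<forall>J \<in> kIK K. \<forall>I. I \<subseteq> J \<longrightarrow> closedin (ET K J) (filt K I J)) \<and>
     (\<forall>J \<in> kIK K. filt K J J = topspace (ET K J) \<and>
                   filt K {} J = zr K J ` topspace (UT K J)) \<and>
     (\<forall>J \<in> kIK K. \<forall>L \<in> kIK K. \<forall>I. I \<subseteq> J \<and> J \<subset> L \<longrightarrow>
        Phi K J L ` {e \<in> topspace (ET K J). prj K J e \<in> dom K J L \<and> e \<in> filt K I J}
        = {e \<in> filt K I L. prj K L e \<in> phi K J L ` dom K J L}) \<and>
     (\<forall>J \<in> kIK K. \<forall>I H. I \<subseteq> J \<and> H \<subseteq> J \<longrightarrow>
        filt K I J \<inter> filt K H J = filt K (I \<inter> H) J) \<and>
     (\<forall>I \<in> kIK K. \<forall>J \<in> kIK K. I \<subset> J \<longrightarrow>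
        openin (subtopology (UT K J) {x \<in> topspace (UT K J). sc K J x \<in> filt K I J})
               (phi K I J ` dom K I J))"

definition tame :: "('x,'u,'e,'z) kur_data_scheme \<Rightarrow> bool" where
  "tame K \<longleftrightarrow>
     (\<forall>I \<in> kIK K. \<forall>J \<in> kIK K. \<forall>L \<in> kIK K. I \<subseteq> J \<and> I \<subseteq> L \<longrightarrow>
        domc K I J \<inter> domc K I L = (if J \<union> L \<in> kIK K then domc K I (J \<union> L) else {})) \<and>
     (\<forall>I \<in> kIK K. \<forall>J \<in> kIK K. \<forall>L \<in> kIK K. I \<subseteq> J \<and> J \<subseteq> L \<longrightarrow>
        phic K I J ` domc K I L = {x \<in> domc K J L. sc K J x \<in> filt K I J})"

definition tame_kur_atlas :: "'x topology \<Rightarrow> ('x,'u,'e,'z) kur_data_scheme \<Rightarrow> bool" where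
  "tame_kur_atlas X K \<longleftrightarrow> kur_atlas X K \<and> filtered K \<and> tame K"

section \<open>The relation defining |K|\<close>

definition kur_step :: "('x,'u,'e,'z) kur_data_scheme \<Rightarrow> ((nat set \<times> 'u) \<times> (nat set \<times> 'u)) set" where
  "kur_step K = {((I, x), (J, phic K I J x)) | I J x.
                   I \<in> kIK K \<and> J \<in> kIK K \<and> I \<subseteq> J \<and> x \<in> domc K I J}"

text \<open>The equivalence relation generated by the steps (on the disjoint union of the U_I);
(I,x) ~ (J,y) iff pi_K(I,x) = pi_K(J,y).\<close>
definition kur_rel :: "('x,'u,'e,'z) kur_data_scheme \<Rightarrow> ((nat set \<times> 'u) \<times> (nat set \<times> 'u)) set" where
  "kur_rel K = (kur_step K \<union> (kur_step K)\<inverse>)\<^sup>*"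

section \<open>Reductions\<close>

definition reduction :: "('x,'u,'e,'z) kur_data_scheme \<Rightarrow> (nat set \<Rightarrow> 'u set) \<Rightarrow> bool" where
  "reduction K V \<longleftrightarrow>
     (\<forall>I \<in> kIK K. openin (UT K I) (V I) \<and> compactin (UT K I) (UT K I closure_of V I) \<and>
                   (V I \<noteq> {} \<longrightarrow> V I \<inter> zero_set K I \<noteq> {})) \<and>
     (\<forall>I \<in> kIK K. \<forall>J \<in> kIK K.
        (\<exists>x \<in> UT K I closure_of V I. \<exists>y \<in> UT K J closure_of V J. ((I, x), (J, y)) \<in> kur_rel K)
        \<longrightarrow> I \<subseteq> J \<or> J \<subseteq> I) \<and>
     (\<forall>I \<in> kIK K. \<forall>x \<in> zero_set K I. \<exists>J \<in> kIK K. \<exists>y \<in> V J. ((I, x), (J, y)) \<in> kur_rel K)"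

text \<open>Nested reduction C \<sqsubset> V.\<close>
definition nested_reduction :: "('x,'u,'e,'z) kur_data_scheme \<Rightarrow> (nat set \<Rightarrow> 'u set) \<Rightarrow> (nat set \<Rightarrow> 'u set) \<Rightarrow> bool" where
  "nested_reduction K C V \<longleftrightarrow> reduction K C \<and> reduction K V \<and>
     (\<forall>I \<in> kIK K. C I \<subseteq> V I \<and>
        compactin (subtopology (UT K I) (V I)) (subtopology (UT K I) (V I) closure_of C I))"

section \<open>Generic topology notions\<close>

text \<open>Quotient of a topological space by a relation r (assumed to be an equivalence
on the carrier): points are the classes r``{x}, with the quotient topology.\<close>
definition quot_topology :: "'a topology \<Rightarrow> ('a \<times> 'a) set \<Rightarrow> 'a set topology" where
  "quot_topology T r = topology (\<lambda>W. W \<subseteq> (\<lambda>x. r``{x}) ` topspace T \<and>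
                                     openin T {x \<in> topspace T. r``{x} \<in> W})"

lemma istopology_quot:
  "istopology (\<lambda>W. W \<subseteq> (\<lambda>x. r``{x}) ` topspace T \<and>
                     openin T {x \<in> topspace T. r``{x} \<in> W})"
proof -
  have i: "{x \<in> topspace T. r``{x} \<in> S \<inter> W} = {x \<in> topspace T. r``{x} \<in> S} \<inter> {x \<in> topspace T. r``{x} \<in> W}" for S W
    by blast
  have u: "{x \<in> topspace T. r``{x} \<in> \<Union>\<K>} = (\<Union>W\<in>\<K>. {x \<in> topspace T. r``{x} \<in> W})" for \<K>
    by blast
  show ?thesis
    unfolding istopology_def
  proof (rule conjI; intro allI impI)
    fix S W
    assume "S \<subseteq> (\<lambda>x. r``{x}) ` topspace T \<and> openin T {x \<in> topspace T. r``{x} \<in> S}"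
      "W \<subseteq> (\<lambda>x. r``{x}) ` topspace T \<and> openin T {x \<in> topspace T. r``{x} \<in> W}"
    then show "S \<inter> W \<subseteq> (\<lambda>x. r``{x}) ` topspace T \<and> openin T {x \<in> topspace T. r``{x} \<in> S \<inter> W}"
      using openin_Int[of T "{x \<in> topspace T. r``{x} \<in> S}" "{x \<in> topspace T. r``{x} \<in> W}"]
      by (simp only: i) blast
  next
    fix \<K> assume a: "\<forall>W\<in>\<K>. W \<subseteq> (\<lambda>x. r``{x}) ` topspace T \<and> openin T {x \<in> topspace T. r``{x} \<in> W}"
    then show "\<Union>\<K> \<subseteq> (\<lambda>x. r``{x}) ` topspace T \<and> openin T {x \<in> topspace T. r``{x} \<in> \<Union>\<K>}"
      using openin_Union[of "(\<lambda>W. {x \<in> topspace T. r``{x} \<in> W}) ` \<K>" T]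
      by (simp only: u) blast
  qed
qed

definition seq_compact_space :: "'a topology \<Rightarrow> bool" where
  "seq_compact_space T \<longleftrightarrow>
     (\<forall>f. (\<forall>n. f n \<in> topspace T) \<longrightarrow>
        (\<exists>l \<in> topspace T. \<exists>r::nat\<Rightarrow>nat. strict_mono r \<and> limitin T (f \<circ> r) l sequentially))"

section \<open>The zero set |Z| of a compatible family of sections\<close>

definition Zset :: "('x,'u,'e,'z) kur_data_scheme \<Rightarrow> (nat set \<Rightarrow> 'u set) \<Rightarrow> (nat set \<Rightarrow> 'u \<Rightarrow> 'e) \<Rightarrow> (nat set \<times> 'u) set" where
  "Zset K V \<sigma> = {(I, x). I \<in> kIK K \<and> x \<in> V I \<and> \<sigma> I x = zr K I x}"

text \<open>Disjoint union of the domains U_I, I in I_K.\<close>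
definition kur_sum :: "('x,'u,'e,'z) kur_data_scheme \<Rightarrow> (nat set \<times> 'u) topology" where
  "kur_sum K = sum_topology (UT K) (kIK K)"

definition Z_rel :: "('x,'u,'e,'z) kur_data_scheme \<Rightarrow> (nat set \<Rightarrow> 'u set) \<Rightarrow> (nat set \<Rightarrow> 'u \<Rightarrow> 'e) \<Rightarrow> ((nat set \<times> 'u) \<times> (nat set \<times> 'u)) set" where
  "Z_rel K V \<sigma> = (let S = kur_step K \<inter> (Zset K V \<sigma> \<times> Zset K V \<sigma>) in (S \<union> S\<inverse>)\<^sup>*)"

definition Z_quot :: "('x,'u,'e,'z) kur_data_scheme \<Rightarrow> (nat set \<Rightarrow> 'u set) \<Rightarrow> (nat set \<Rightarrow> 'u \<Rightarrow> 'e) \<Rightarrow> (nat set \<times> 'u) set topology" where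
  "Z_quot K V \<sigma> = quot_topology (subtopology (kur_sum K) (Zset K V \<sigma>)) (Z_rel K V \<sigma>)"

end

theory Submission
  imports Defs
begin

text \<open>
  In a tame atlas two points of the charts I and J are identified in |K| iff they have the same image
  in the chart indexed by I \<union> J. Hence, for nested I and J, the relation between
  U_I and U_J is just the graph of the embedding phi_IJ, whose image is closed in U_J by tameness; so
  the relation is closed. The separation property of the reduction V leaves only nested pairs, and
  therefore the relation on Z is closed as well. The points of Z in the closures of the
  C_J in V_J form a compact set meeting every equivalence class. The quotient of a Hausdorff space by
  a closed relation with such a compact set is Hausdorff, and a sequence in the quotient can be lifted to
  the compact set and has a convergent subsequence there.
\<close>

section \<open>Quotients by closed relations\<close>

lemma openin_quot_topology:
  "openin (quot_topology T r) W \<longleftrightarrow>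
     W \<subseteq> (\<lambda>x. r``{x}) ` topspace T \<and> openin T {x \<in> topspace T. r``{x} \<in> W}"
  unfolding quot_topology_def by (simp add: istopology_quot)

lemma topspace_quot_topology: "topspace (quot_topology T r) = (\<lambda>x. r``{x}) ` topspace T"
proof -
  have "{x \<in> topspace T. r``{x} \<in> (\<lambda>x. r``{x}) ` topspace T} = topspace T"
    by blast
  then have "openin (quot_topology T r) ((\<lambda>x. r``{x}) ` topspace T)"
    by (simp add: openin_quot_topology)
  then show ?thesis
    using openin_topspace[of "quot_topology T r", unfolded openin_quot_topology] openin_subset
    by (metis subset_antisym)
qed

lemma continuous_map_quot_topology: "continuous_map T (quot_topology T r) (\<lambda>x. r``{x})"
  by (auto simp: continuous_map_def topspace_quot_topology openin_quot_topology)

text \<open>The set is the projection to the first factor of the part of \<open>r\<close> lying over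
  \<open>B\<close>, and projecting along a compact factor is a closed map.\<close>

lemma closedin_saturation_compactin:
  assumes R: "closedin (prod_topology T T) (r \<inter> (topspace T \<times> topspace T))"
    and B: "compactin T B"
  shows "closedin T {t \<in> topspace T. \<exists>b\<in>B. (t, b) \<in> r}"
proof -
  have sub: "B \<subseteq> topspace T"
    using B compactin_subset_topspace by blast
  \<comment> \<open>Viewing \<open>B\<close> as a compact space in its own right makes
    \<open>closed_map_fst\<close> applicable.\<close>
  have eq: "prod_topology T (subtopology T B) = subtopology (prod_topology T T) (UNIV \<times> B)"
    by (simp add: subtopology_Times)
  have "closedin (prod_topology T (subtopology T B))
          (r \<inter> (topspace T \<times> topspace T) \<inter> (UNIV \<times> B))"
    unfolding eq using R by (metis closedin_subtopology)
  moreover have "closed_map (prod_topology T (subtopology T B)) T fst"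
    using B by (simp add: closed_map_fst compact_space_subtopology)
  ultimately have "closedin T (fst ` (r \<inter> (topspace T \<times> topspace T) \<inter> (UNIV \<times> B)))"
    by (simp add: closed_map_def)
  moreover have "fst ` (r \<inter> (topspace T \<times> topspace T) \<inter> (UNIV \<times> B))
      = {t \<in> topspace T. \<exists>b\<in>B. (t, b) \<in> r}"
    using sub by force
  ultimately show ?thesis by simp
qed

text \<open>Two distinct classes cut the compact Hausdorff space \<open>Q\<close> in disjoint closed
  sets, which normality separates by sets \<open>G\<close> and \<open>H\<close> open in
  \<open>Q\<close>. The points whose class meets \<open>Q\<close> only inside \<open>G\<close> form
  an open union of classes, and likewise for \<open>H\<close>; since every class meets
  \<open>Q\<close>, the two unions are disjoint.\<close>

lemma Hausdorff_space_quot_topology: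
  assumes eq: "equiv UNIV r"
    and R: "closedin (prod_topology T T) (r \<inter> (topspace T \<times> topspace T))"
    and T: "Hausdorff_space T" and Q: "compactin T Q"
    and meets: "\<And>x. x \<in> topspace T \<Longrightarrow> \<exists>q\<in>Q. (x, q) \<in> r"
  shows "Hausdorff_space (quot_topology T r)"
  unfolding Hausdorff_space_def topspace_quot_topology
proof (clarify)
  fix p q assume p: "p \<in> topspace T" and q: "q \<in> topspace T" and ne: "r``{p} \<noteq> r``{q}"
  have r_sym: "\<And>a b. (a, b) \<in> r \<Longrightarrow> (b, a) \<in> r"
    and r_trans: "\<And>a b c. (a, b) \<in> r \<Longrightarrow> (b, c) \<in> r \<Longrightarrow> (a, c) \<in> r"
    using eq by (meson equivE symD transD)+
  have class_eq: "(a, b) \<in> r \<longleftrightarrow> r``{a} = r``{b}" for a b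
    using eq by (simp add: eq_equiv_class_iff)
  have QT: "Q \<subseteq> topspace T"
    using Q compactin_subset_topspace by blast
  define S where "S = subtopology T Q"
  have topS: "topspace S = Q"
    using QT unfolding S_def by (simp add: inf.absorb2)
  have comp: "compact_space S" and haus: "Hausdorff_space S"
    using Q T by (auto simp: S_def compact_space_subtopology Hausdorff_space_subtopology)
  then have normal: "normal_space S"
    using compact_Hausdorff_or_regular_imp_normal_space by blast
  have class_closed: "closedin S {x \<in> Q. (x, a) \<in> r}" if "a \<in> topspace T" for a
  proof -
    have "closedin T {t \<in> topspace T. \<exists>b\<in>{a}. (t, b) \<in> r}"
      by (rule closedin_saturation_compactin[OF R]) (use that in simp)
    then have "closedin S (Q \<inter> {t \<in> topspace T. \<exists>b\<in>{a}. (t, b) \<in> r})"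
      unfolding S_def closedin_subtopology by blast
    moreover have "Q \<inter> {t \<in> topspace T. \<exists>b\<in>{a}. (t, b) \<in> r} = {x \<in> Q. (x, a) \<in> r}"
      using QT by blast
    ultimately show ?thesis by simp
  qed
  have "disjnt {x \<in> Q. (x, p) \<in> r} {x \<in> Q. (x, q) \<in> r}"
    using ne class_eq by (auto simp: disjnt_iff)
  then obtain G H where G: "openin S G" "{x \<in> Q. (x, p) \<in> r} \<subseteq> G"
    and H: "openin S H" "{x \<in> Q. (x, q) \<in> r} \<subseteq> H" and GH: "disjnt G H"
    using normal class_closed[OF p] class_closed[OF q] unfolding normal_space_def by meson
  define sat where "sat B = {t \<in> topspace T. \<exists>b\<in>B. (t, b) \<in> r}" for B
  \<comment> \<open>For \<open>W\<close> open in \<open>Q\<close>, the rest \<open>Q - W\<close> is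
    compact, so its saturation is closed. The complement of the saturation is a union of classes
    within \<open>T\<close>, hence it is the full preimage of its image, and the image is open in
    the quotient.\<close>
  have key: "openin (quot_topology T r) ((\<lambda>x. r``{x}) ` (topspace T - sat (Q - W)))
     \<and> (\<forall>t \<in> topspace T. r``{t} \<in> (\<lambda>x. r``{x}) ` (topspace T - sat (Q - W)) \<longrightarrow> t \<notin> sat (Q - W))"
    if "openin S W" for W
  proof -
    have "closedin S (Q - W)"
      using that topS by (metis closedin_diff closedin_topspace)
    then have "compactin T (Q - W)"
      using comp closedin_compact_space compactin_subtopology S_def by metis
    then have "closedin T (sat (Q - W))"
      unfolding sat_def by (rule closedin_saturation_compactin[OF R])
    then have op: "openin T (topspace T - sat (Q - W))"
      by blast
    have cls: "t \<notin> sat (Q - W)"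
      if t: "t \<in> topspace T" and cl: "r``{t} \<in> (\<lambda>x. r``{x}) ` (topspace T - sat (Q - W))" for t
    proof
      assume "t \<in> sat (Q - W)"
      then obtain b where b: "b \<in> Q - W" "(t, b) \<in> r"
        unfolding sat_def by blast
      obtain y where y: "y \<in> topspace T" "y \<notin> sat (Q - W)" "r``{t} = r``{y}"
        using cl by blast
      then have "(y, b) \<in> r"
        using b class_eq by simp
      then show False
        using y b unfolding sat_def by blast
    qed
    have "{x \<in> topspace T. r``{x} \<in> (\<lambda>x. r``{x}) ` (topspace T - sat (Q - W))}
        = topspace T - sat (Q - W)"
      using cls by blast
    with op cls show ?thesis
      by (auto simp: openin_quot_topology)
  qed
  have in_sat: "r``{a} \<in> (\<lambda>x. r``{x}) ` (topspace T - sat (Q - W))"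
    if "a \<in> topspace T" "{x \<in> Q. (x, a) \<in> r} \<subseteq> W" for a W
    using that r_sym unfolding sat_def by blast
  have "disjnt ((\<lambda>x. r``{x}) ` (topspace T - sat (Q - G))) ((\<lambda>x. r``{x}) ` (topspace T - sat (Q - H)))"
  proof (clarsimp simp: disjnt_iff)
    fix t u assume t: "t \<in> topspace T" "t \<notin> sat (Q - G)" and u: "u \<in> topspace T" "u \<notin> sat (Q - H)"
      and tu: "r``{t} = r``{u}"
    \<comment> \<open>A class in both images has a representative \<open>z\<close> in
      \<open>Q\<close>, which can lie neither in \<open>Q - G\<close> nor in
      \<open>Q - H\<close>.\<close>
    obtain z where z: "z \<in> Q" "(t, z) \<in> r"
      using meets t by blast
    then have "(u, z) \<in> r"
      using tu class_eq by simp
    then have "z \<in> G \<inter> H"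
      using z t u unfolding sat_def by blast
    then show False
      using GH by (auto simp: disjnt_iff)
  qed
  then show "\<exists>A B. openin (quot_topology T r) A \<and> openin (quot_topology T r) B \<and>
      r``{p} \<in> A \<and> r``{q} \<in> B \<and> disjnt A B"
    using key[OF G(1)] key[OF H(1)] in_sat[OF p G(2)] in_sat[OF q H(2)] by blast
qed

text \<open>Every class has a representative in \<open>Q\<close>: a sequence of classes lifts to
  \<open>Q\<close>, a subsequence converges there, and the continuous projection carries the limit
  back down.\<close>

lemma seq_compact_space_quot_topology:
  assumes "equiv UNIV r" and "Q \<subseteq> topspace T"
    and seq: "\<And>f :: nat \<Rightarrow> 'a. range f \<subseteq> Q \<Longrightarrow>
      \<exists>l\<in>Q. \<exists>k::nat\<Rightarrow>nat. strict_mono k \<and> limitin T (f \<circ> k) l sequentially"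
    and meets: "\<And>x. x \<in> topspace T \<Longrightarrow> \<exists>q\<in>Q. (x, q) \<in> r"
  shows "seq_compact_space (quot_topology T r)"
  unfolding seq_compact_space_def topspace_quot_topology
proof (intro allI impI)
  fix f :: "nat \<Rightarrow> 'a set" assume f: "\<forall>n. f n \<in> (\<lambda>x. r``{x}) ` topspace T"
  have "\<exists>q\<in>Q. f n = r``{q}" for n
    using f meets assms(1) by (metis (no_types, lifting) equiv_class_eq imageE)
  then obtain g where g: "\<And>n. g n \<in> Q" "\<And>n. f n = r``{g n}"
    by metis
  then obtain l k where l: "l \<in> Q" and k: "strict_mono (k::nat\<Rightarrow>nat)" "limitin T (g \<circ> k) l sequentially"
    using seq[of g] by blast
  have "limitin (quot_topology T r) ((\<lambda>x. r``{x}) \<circ> (g \<circ> k)) (r``{l}) sequentially"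
    using continuous_map_quot_topology k(2) by (rule continuous_map_limit)
  moreover have "(\<lambda>x. r``{x}) \<circ> (g \<circ> k) = f \<circ> k"
    using g by auto
  ultimately show "\<exists>l\<in>(\<lambda>x. r``{x}) ` topspace T. \<exists>k. strict_mono k \<and>
      limitin (quot_topology T r) (f \<circ> k) l sequentially"
    using k(1) l assms(2) by auto
qed

section \<open>Sum topologies\<close>

lemma continuous_map_in_topspace:
  "continuous_map X Y f \<Longrightarrow> x \<in> topspace X \<Longrightarrow> f x \<in> topspace Y"
  using continuous_map_image_subset_topspace by blast

lemma Hausdorff_space_sum_topology:
  assumes "\<And>i. i \<in> I \<Longrightarrow> Hausdorff_space (X i)"
  shows "Hausdorff_space (sum_topology X I)"
  unfolding Hausdorff_space_def
proof (intro allI impI)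
  fix p q
  assume pq: "p \<in> topspace (sum_topology X I) \<and> q \<in> topspace (sum_topology X I) \<and> p \<noteq> q"
  obtain i x j y where p: "p = (i, x)" and q: "q = (j, y)"
    by (cases p, cases q) blast
  have i: "i \<in> I" "x \<in> topspace (X i)" and j: "j \<in> I" "y \<in> topspace (X j)"
    and ne: "i = j \<longrightarrow> x \<noteq> y"
    using pq p q by auto
  have op: "openin (sum_topology X I) (Pair k ` W)" if "k \<in> I" "openin (X k) W" for k W
    using open_map_component_injection[OF that(1), of X] that(2) by (simp add: open_map_def)
  show "\<exists>U V. openin (sum_topology X I) U \<and> openin (sum_topology X I) V \<and>
      p \<in> U \<and> q \<in> V \<and> disjnt U V"
  proof (cases "i = j")
    case True
    then obtain A B where "openin (X i) A" "openin (X i) B" "x \<in> A" "y \<in> B" "disjnt A B"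
      using assms[OF i(1), unfolded Hausdorff_space_def, rule_format, of x y] i j ne by blast
    moreover from this have "disjnt (Pair i ` A) (Pair i ` B)"
      by (auto simp: disjnt_iff)
    ultimately show ?thesis
      using op[OF i(1)] True
      by - (rule exI[of _ "Pair i ` A"], rule exI[of _ "Pair i ` B"], simp add: p q)
  next
    case False
    then have "disjnt (Pair i ` topspace (X i)) (Pair j ` topspace (X j))"
      by (auto simp: disjnt_iff)
    then show ?thesis
      using op[OF i(1) openin_topspace] op[OF j(1) openin_topspace] i(2) j(2)
      by - (rule exI[of _ "Pair i ` topspace (X i)"], rule exI[of _ "Pair j ` topspace (X j)"],
          simp add: p q)
  qed
qed

text \<open>The injections of the summands are open maps, so a box around a point of the block with
  indices \<open>i\<close>, \<open>j\<close> is also a box in the product of the sums. Openness of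
  the complement can thus be tested block by block.\<close>

lemma closedin_prod_sum_topology:
  assumes sub: "R \<subseteq> topspace (sum_topology X I) \<times> topspace (sum_topology Y J)"
    and cl: "\<And>i j. i \<in> I \<Longrightarrow> j \<in> J \<Longrightarrow>
      closedin (prod_topology (X i) (Y j)) {(x, y). ((i, x), (j, y)) \<in> R}"
  shows "closedin (prod_topology (sum_topology X I) (sum_topology Y J)) R"
proof -
  have "openin (prod_topology (sum_topology X I) (sum_topology Y J))
      (topspace (sum_topology X I) \<times> topspace (sum_topology Y J) - R)"
    unfolding openin_prod_topology_alt
  proof (clarify)
    fix i x j y
    assume ix: "(i, x) \<in> topspace (sum_topology X I)" and jy: "(j, y) \<in> topspace (sum_topology Y J)"
      and nr: "((i, x), j, y) \<notin> R"
    then have i: "i \<in> I" "x \<in> topspace (X i)" and j: "j \<in> J" "y \<in> topspace (Y j)"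
      by auto
    have "openin (prod_topology (X i) (Y j))
        (topspace (prod_topology (X i) (Y j)) - {(x, y). ((i, x), (j, y)) \<in> R})"
      using cl[OF i(1) j(1)] by blast
    moreover have "(x, y) \<in> topspace (prod_topology (X i) (Y j)) - {(x, y). ((i, x), (j, y)) \<in> R}"
      using i j nr by simp
    ultimately obtain A B where AB: "openin (X i) A" "openin (Y j) B" "x \<in> A" "y \<in> B"
      "A \<times> B \<subseteq> topspace (prod_topology (X i) (Y j)) - {(x, y). ((i, x), (j, y)) \<in> R}"
      unfolding openin_prod_topology_alt by meson
    have "openin (sum_topology X I) (Pair i ` A)" "openin (sum_topology Y J) (Pair j ` B)"
      using open_map_component_injection[OF i(1), of X] open_map_component_injection[OF j(1), of Y] AB(1,2)
      by (simp_all add: open_map_def)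
    moreover have "Pair i ` A \<times> Pair j ` B
        \<subseteq> topspace (sum_topology X I) \<times> topspace (sum_topology Y J) - R"
      using AB(5) i j by auto
    ultimately show "\<exists>U V. openin (sum_topology X I) U \<and> openin (sum_topology Y J) V \<and>
        (i, x) \<in> U \<and> (j, y) \<in> V \<and>
        U \<times> V \<subseteq> topspace (sum_topology X I) \<times> topspace (sum_topology Y J) - R"
      using AB(3,4) by (intro exI[of _ "Pair i ` A"] exI[of _ "Pair j ` B"]) simp
  qed
  then show ?thesis
    using sub by (simp add: closedin_def)
qed

lemma compactin_metrizable_subsequence:
  assumes "metrizable_space T" and "compactin T Q" and "range f \<subseteq> Q"
  obtains l and k :: "nat \<Rightarrow> nat"
    where "l \<in> Q" "strict_mono k" "limitin T (f \<circ> k) l sequentially"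
proof -
  obtain M d where M: "Metric_space M d" "T = Metric_space.mtopology M d"
    using assms(1) unfolding metrizable_space_def by blast
  show ?thesis
    using assms Metric_space.compactin_sequentially[OF M(1)] that unfolding M(2) by meson
qed

lemma sum_topology_subsequence:
  assumes fin: "finite I" and met: "\<And>i. i \<in> I \<Longrightarrow> metrizable_space (X i)"
    and comp: "\<And>i. i \<in> I \<Longrightarrow> compactin (X i) (Q i)" and f: "range f \<subseteq> Sigma I Q"
  obtains l and k :: "nat \<Rightarrow> nat"
    where "l \<in> Sigma I Q" "strict_mono k" "limitin (sum_topology X I) (f \<circ> k) l sequentially"
proof -
  have "range (fst \<circ> f) \<subseteq> I"
    using f by fastforce
  then have "finite (range (fst \<circ> f))"
    using fin finite_subset by blast
  \<comment> \<open>With finitely many summands, some index is hit infinitely often;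
    \<open>h\<close> enumerates those times, and the problem reduces to one compact metrizable
    piece.\<close>
  then obtain n0 where inf: "infinite {n. (fst \<circ> f) n = (fst \<circ> f) n0}"
    using pigeonhole_infinite[of UNIV "fst \<circ> f"] by auto
  define i where "i = fst (f n0)"
  obtain h :: "nat \<Rightarrow> nat" where h: "strict_mono h" "\<And>n. fst (f (h n)) = i"
    using infinite_enumerate[OF inf] unfolding i_def by auto
  have i: "i \<in> I"
    using f unfolding i_def by (metis SigmaE fst_conv range_subsetD)
  have "range (snd \<circ> f \<circ> h) \<subseteq> Q i"
  proof clarsimp
    fix n show "snd (f (h n)) \<in> Q i"
      using f h(2)[of n] by (metis SigmaD2 prod.collapse range_subsetD)
  qed
  then obtain l and k :: "nat \<Rightarrow> nat"
    where k: "l \<in> Q i" "strict_mono k" "limitin (X i) (snd \<circ> f \<circ> h \<circ> k) l sequentially"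
    using compactin_metrizable_subsequence[OF met[OF i] comp[OF i]] by blast
  have "limitin (sum_topology X I) (Pair i \<circ> (snd \<circ> f \<circ> h \<circ> k)) (i, l) sequentially"
    by (rule continuous_map_limit) (use i k(3) in \<open>auto intro: continuous_map_component_injection\<close>)
  moreover have "Pair i \<circ> (snd \<circ> f \<circ> h \<circ> k) = f \<circ> (h \<circ> k)"
    using h(2) by (auto simp: fun_eq_iff prod_eq_iff)
  ultimately show ?thesis
    using that[of "(i, l)" "h \<circ> k"] i k h(1) by (simp add: strict_mono_o)
qed

text \<open>Over the image the graph is the locus where the first coordinate equals the continuous
  inverse \<open>g\<close> of the second, hence closed by the Hausdorff property of
  \<open>X\<close>. Closedness of the image, rather than of \<open>S\<close>, extends this to all of
  \<open>Y\<close>; this suits the domains of coordinate changes, which are open.\<close>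

lemma closedin_embedding_map_graph:
  assumes f: "embedding_map (subtopology X S) Y f" and S: "S \<subseteq> topspace X"
    and X: "Hausdorff_space X" and im: "closedin Y (f ` S)"
  shows "closedin (prod_topology X Y) {(x, y). x \<in> S \<and> f x = y}"
proof -
  have "homeomorphic_map (subtopology X S) (subtopology Y (f ` S)) f"
    using f S by (simp add: embedding_map_def inf.absorb2)
  then obtain g where g: "homeomorphic_maps (subtopology X S) (subtopology Y (f ` S)) f g"
    using homeomorphic_map_maps by blast
  then have "continuous_map (subtopology Y (f ` S)) X g"
    unfolding homeomorphic_maps_def by (simp add: continuous_map_in_subtopology)
  then have "closedin (prod_topology X (subtopology Y (f ` S)))
      {p \<in> topspace (prod_topology X (subtopology Y (f ` S))). fst p = (g \<circ> snd) p}"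
    by (intro closedin_continuous_maps_eq[OF X] continuous_map_fst
        continuous_map_compose[OF continuous_map_snd])
  moreover have "{p \<in> topspace (prod_topology X (subtopology Y (f ` S))). fst p = (g \<circ> snd) p}
      = {(x, y). x \<in> S \<and> f x = y}"
  proof -
    have gf: "\<forall>x\<in>S. g (f x) = x"
      using g S unfolding homeomorphic_maps_def by (simp add: inf.absorb2)
    have "topspace (subtopology Y (f ` S)) = f ` S"
      using closedin_subset[OF im] by (simp add: inf.absorb2)
    then have "p \<in> topspace (prod_topology X (subtopology Y (f ` S))) \<and> fst p = (g \<circ> snd) p
        \<longleftrightarrow> fst p \<in> S \<and> f (fst p) = snd p" for p
      using gf S by (cases p) auto
    then show ?thesis by auto
  qed
  ultimately have "closedin (subtopology (prod_topology X Y) (topspace X \<times> f ` S))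
      {(x, y). x \<in> S \<and> f x = y}"
    by (simp only: prod_topology_subtopology)
  moreover have "closedin (prod_topology X Y) (topspace X \<times> f ` S)"
    using im by (simp add: closedin_prod_Times_iff)
  ultimately show ?thesis
    by (rule closedin_trans_full)
qed

section \<open>The identifications in a tame atlas\<close>

lemma finite_kIK: "finite (kIK K)"
  unfolding kIK_def by (rule finite_subset[of _ "Pow {1..nb K}"]) auto

lemma kIK_mono: "J \<in> kIK K \<Longrightarrow> I \<subseteq> J \<Longrightarrow> I \<noteq> {} \<Longrightarrow> I \<in> kIK K"
proof -
  assume "J \<in> kIK K" and "I \<subseteq> J" and "I \<noteq> {}"
  moreover have "(\<Inter>i\<in>J. fp K {i}) \<subseteq> (\<Inter>i\<in>I. fp K {i})"
    using \<open>I \<subseteq> J\<close> by (rule INF_superset_mono) simp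
  ultimately show "I \<in> kIK K"
    unfolding kIK_def by auto
qed

locale tame_kuranishi =
  fixes X :: "'x topology" and K :: "('x, 'u, 'e) kur_data"
  assumes tame_K: "tame_kur_atlas X K"
begin

lemma chart: "I \<in> kIK K \<Longrightarrow> kur_chart X K I"
  using tame_K unfolding tame_kur_atlas_def kur_atlas_def by blast

lemma change: "I \<in> kIK K \<Longrightarrow> J \<in> kIK K \<Longrightarrow> I \<subset> J \<Longrightarrow> coord_change K I J"
  using tame_K unfolding tame_kur_atlas_def kur_atlas_def by blast

lemma domc_subset: "I \<in> kIK K \<Longrightarrow> J \<in> kIK K \<Longrightarrow> I \<subseteq> J \<Longrightarrow> domc K I J \<subseteq> topspace (UT K I)"
  using change[of I J] openin_subset[of "UT K I" "dom K I J"] unfolding coord_change_def domc_def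
  by (cases "I = J") auto

lemma embedding_map_phic:
  "I \<in> kIK K \<Longrightarrow> J \<in> kIK K \<Longrightarrow> I \<subseteq> J \<Longrightarrow>
    embedding_map (subtopology (UT K I) (domc K I J)) (UT K J) (phic K I J)"
  using change[of I J] unfolding coord_change_def domc_def phic_def
  by (cases "I = J") (auto simp: embedding_map_def)

lemma phic_in_topspace:
  assumes "I \<in> kIK K" "J \<in> kIK K" "I \<subseteq> J" "x \<in> domc K I J"
  shows "phic K I J x \<in> topspace (UT K J)"
proof -
  have "continuous_map (subtopology (UT K I) (domc K I J)) (UT K J) (phic K I J)"
    using homeomorphic_imp_continuous_map[OF embedding_map_phic[OF assms(1-3), unfolded embedding_map_def]]
    by (simp add: continuous_map_in_subtopology)
  moreover have "x \<in> topspace (subtopology (UT K I) (domc K I J))"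
    using domc_subset[OF assms(1-3)] assms(4) by auto
  ultimately show ?thesis
    by (rule continuous_map_in_topspace)
qed

lemma inj_on_phic:
  assumes "I \<in> kIK K" "J \<in> kIK K" "I \<subseteq> J"
  shows "inj_on (phic K I J) (domc K I J)"
  using embedding_map_phic[OF assms] domc_subset[OF assms]
  by (metis embedding_map_def homeomorphic_imp_injective_map topspace_subtopology_subset)

text \<open>This is the intersection identity of tameness in the case
  \<open>J \<union> L = L\<close>.\<close>

lemma domc_antimono:
  assumes "I \<in> kIK K" "J \<in> kIK K" "L \<in> kIK K" "I \<subseteq> J" "J \<subseteq> L"
  shows "domc K I L \<subseteq> domc K I J"
proof -
  have "domc K I J \<inter> domc K I L = (if J \<union> L \<in> kIK K then domc K I (J \<union> L) else {})"
    using tame_K assms unfolding tame_kur_atlas_def tame_def by (meson subset_trans)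
  also have "J \<union> L = L"
    using assms by blast
  finally show ?thesis
    using assms by auto
qed

text \<open>A common point rules out the empty branch of the tameness identity, which is how
  \<open>J \<union> L\<close> is seen to be an index.\<close>

lemma domc_Int:
  assumes "I \<in> kIK K" "J \<in> kIK K" "L \<in> kIK K" "I \<subseteq> J" "I \<subseteq> L" "x \<in> domc K I J" "x \<in> domc K I L"
  shows "J \<union> L \<in> kIK K" "x \<in> domc K I (J \<union> L)"
proof -
  have "domc K I J \<inter> domc K I L = (if J \<union> L \<in> kIK K then domc K I (J \<union> L) else {})"
    using tame_K assms unfolding tame_kur_atlas_def tame_def by meson
  then show "J \<union> L \<in> kIK K" "x \<in> domc K I (J \<union> L)"
    using assms(6,7) by (metis IntI empty_iff)+
qed

lemma phic_image_domc:
  assumes "I \<in> kIK K" "J \<in> kIK K" "L \<in> kIK K" "I \<subseteq> J" "J \<subseteq> L"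
  shows "phic K I J ` domc K I L = {x \<in> domc K J L. sc K J x \<in> filt K I J}"
  using tame_K assms unfolding tame_kur_atlas_def tame_def by meson

text \<open>The image identity of tameness with equal last indices exhibits the image as the
  preimage of a closed filtration set under the continuous section.\<close>

lemma closedin_phic_image:
  assumes "I \<in> kIK K" "J \<in> kIK K" "I \<subseteq> J"
  shows "closedin (UT K J) (phic K I J ` domc K I J)"
proof -
  have "phic K I J ` domc K I J = {x \<in> topspace (UT K J). sc K J x \<in> filt K I J}"
    using phic_image_domc[of I J J] assms by (simp add: domc_def)
  moreover have "closedin (ET K J) (filt K I J)"
    using tame_K assms(2,3) unfolding tame_kur_atlas_def filtered_def by simp
  moreover have "continuous_map (UT K J) (ET K J) (sc K J)"
    using chart[OF assms(2)] unfolding kur_chart_def by blast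
  ultimately show ?thesis
    by (simp add: closedin_continuous_map_preimage)
qed

text \<open>The cocycle condition is stated for the bundle maps \<open>Phi\<close>. Evaluating it on
  the zero section transfers it to the base maps, because the zero section of the last chart is
  injective, with left inverse \<open>prj\<close>.\<close>

lemma phic_cocycle:
  assumes I: "I \<in> kIK K" and J: "J \<in> kIK K" and L: "L \<in> kIK K" and "I \<subseteq> J" "J \<subseteq> L"
    and x: "x \<in> domc K I J" "phic K I J x \<in> domc K J L"
  shows "x \<in> domc K I L" "phic K J L (phic K I J x) = phic K I L x"
proof -
  have *: "x \<in> dom K I L \<and> phi K J L (phi K I J x) = phi K I L x"
    if IJ: "I \<subset> J" and JL: "J \<subset> L"
  proof -
    have IL: "I \<subset> L" using IJ JL by blast
    have x': "x \<in> dom K I J" "phi K I J x \<in> dom K J L"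
      using x IJ JL by (auto simp: domc_def phic_def split: if_splits)
    have xU: "x \<in> topspace (UT K I)"
      using x I J \<open>I \<subseteq> J\<close> domc_subset by blast
    have co: "(\<forall>e \<in> topspace (ET K I).
            prj K I e \<in> dom K I J \<inter> phi K I J -` dom K J L \<inter> dom K I L \<longrightarrow>
            Phi K J L (Phi K I J e) = Phi K I L e)"
      "dom K I J \<inter> phi K I J -` dom K J L \<subseteq> dom K I L"
    proof -
      have "cocycle K"
        using tame_K unfolding tame_kur_atlas_def kur_atlas_def by blast
      note * = this[unfolded cocycle_def, rule_format, OF I J L conjI, OF IJ JL]
      show "\<forall>e \<in> topspace (ET K I).
            prj K I e \<in> dom K I J \<inter> phi K I J -` dom K J L \<inter> dom K I L \<longrightarrow>
            Phi K J L (Phi K I J e) = Phi K I L e"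
        "dom K I J \<inter> phi K I J -` dom K J L \<subseteq> dom K I L"
        using *  by simp_all
    qed
    have xL: "x \<in> dom K I L"
      using co(2) x' by blast
    have zI: "zr K I x \<in> topspace (ET K I)" "prj K I (zr K I x) = x"
      using chart[OF I] xU continuous_map_in_topspace[of "UT K I" "ET K I" "zr K I"]
      unfolding kur_chart_def by simp_all
    have "Phi K J L (Phi K I J (zr K I x)) = Phi K I L (zr K I x)"
      using co(1) x' xL zI by simp
    moreover have "Phi K I J (zr K I x) = zr K J (phi K I J x)" "Phi K I L (zr K I x) = zr K L (phi K I L x)"
      "Phi K J L (zr K J (phi K I J x)) = zr K L (phi K J L (phi K I J x))"
      using change[OF I J IJ] change[OF I L IL] change[OF J L JL] x' xL
      unfolding coord_change_def by auto
    ultimately have "zr K L (phi K J L (phi K I J x)) = zr K L (phi K I L x)"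
      by simp
    moreover have "phi K J L (phi K I J x) \<in> topspace (UT K L)" "phi K I L x \<in> topspace (UT K L)"
      using phic_in_topspace[OF J L, of "phi K I J x"] phic_in_topspace[OF I L, of x] x' xL IJ JL IL
      by (simp_all add: phic_def domc_def less_le)
    ultimately have "phi K J L (phi K I J x) = phi K I L x"
      using chart[OF L] unfolding kur_chart_def by metis
    with xL show ?thesis by blast
  qed
  \<comment> \<open>Equal indices are outside the cocycle condition and are settled by the
    conventions U_II = U_I and phi_II = id.\<close>
  consider "I = J" | "J = L" | "I \<subset> J" "J \<subset> L"
    using assms by blast
  then have "x \<in> domc K I L \<and> phic K J L (phic K I J x) = phic K I L x"
    by cases (use x * in \<open>auto simp: phic_def domc_def\<close>)
  then show "x \<in> domc K I L" "phic K J L (phic K I J x) = phic K I L x"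
    by auto
qed

text \<open>This is the explicit form of the generated relation in a tame atlas: the union of the
  two indices is the smallest index of a chart into which both points could be mapped, and chains of
  identifications are replaced by one comparison there.\<close>

definition common_image :: "nat set \<times> 'u \<Rightarrow> nat set \<times> 'u \<Rightarrow> bool" where
  "common_image p q \<longleftrightarrow> fst p \<in> kIK K \<and> fst q \<in> kIK K \<and> fst p \<union> fst q \<in> kIK K \<and>
     snd p \<in> domc K (fst p) (fst p \<union> fst q) \<and> snd q \<in> domc K (fst q) (fst p \<union> fst q) \<and>
     phic K (fst p) (fst p \<union> fst q) (snd p) = phic K (fst q) (fst p \<union> fst q) (snd q)"

text \<open>Since \<open>y\<close> can be mapped both to the old comparison chart \<open>N\<close>
  and to \<open>L\<close>, tameness lets it be mapped to the chart of \<open>N \<union> L\<close>.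
  The image identity places its images in \<open>N\<close> and \<open>L\<close> in the domains
  towards that chart, and the cocycle property makes all routes agree.\<close>

lemma common_image_step_up:
  assumes P: "common_image (I, x) (J, y)" and L: "L \<in> kIK K" and JL: "J \<subseteq> L" and y: "y \<in> domc K J L"
  shows "common_image (I, x) (L, phic K J L y)"
proof -
  define N where "N = I \<union> J"
  define M where "M = I \<union> L"
  have I: "I \<in> kIK K" and J: "J \<in> kIK K" and N: "N \<in> kIK K"
    and xN: "x \<in> domc K I N" and yN: "y \<in> domc K J N" and eq: "phic K I N x = phic K J N y"
    using P unfolding common_image_def N_def by auto
  have NL: "N \<union> L = M" and sub: "I \<subseteq> N" "J \<subseteq> N" "N \<subseteq> M" "L \<subseteq> M" "I \<subseteq> M"
    using JL unfolding N_def M_def by auto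
  have M: "M \<in> kIK K" and yM: "y \<in> domc K J M"
    using domc_Int[OF J N L sub(2) JL yN y] NL by auto
  have yLM: "phic K J L y \<in> domc K L M"
    using phic_image_domc[OF J L M JL sub(4)] yM by blast
  have yNM: "phic K I N x \<in> domc K N M"
    using phic_image_domc[OF J N M sub(2,3)] yM eq by auto
  note a = phic_cocycle[OF J L M JL sub(4) y yLM]
  note b = phic_cocycle[OF I N M sub(1,3) xN yNM]
  note c = phic_cocycle[OF J N M sub(2,3) yN yNM[unfolded eq]]
  show ?thesis
    using I L M b a c yLM eq unfolding common_image_def M_def by simp
qed

text \<open>The new comparison chart \<open>M\<close> is contained in the old one \<open>N\<close>.
  Both points have images in \<open>M\<close> because domains grow as the target index shrinks;
  these images agree in \<open>N\<close>, and the map from \<open>M\<close> to \<open>N\<close> is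
  injective.\<close>

lemma common_image_step_down:
  assumes P: "common_image (I, x) (J, phic K L J z)" and L: "L \<in> kIK K" and LJ: "L \<subseteq> J"
    and z: "z \<in> domc K L J"
  shows "common_image (I, x) (L, z)"
proof -
  define N where "N = I \<union> J"
  define M where "M = I \<union> L"
  have I: "I \<in> kIK K" and J: "J \<in> kIK K" and N: "N \<in> kIK K"
    and xN: "x \<in> domc K I N" and yN: "phic K L J z \<in> domc K J N"
    and eq: "phic K I N x = phic K J N (phic K L J z)"
    using P unfolding common_image_def N_def by auto
  have sub: "I \<subseteq> N" "J \<subseteq> N" "L \<subseteq> M" "I \<subseteq> M" "M \<subseteq> N" "L \<subseteq> N" "M \<noteq> {}"
    using LJ I unfolding N_def M_def kIK_def by auto
  have M: "M \<in> kIK K"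
    using kIK_mono[OF N sub(5,7)] .
  note a = phic_cocycle[OF L J N LJ sub(2) z yN]
  have xM: "x \<in> domc K I M" and zM: "z \<in> domc K L M"
    using domc_antimono[OF I M N sub(4,5)] domc_antimono[OF L M N sub(3,5)] xN a by auto
  have xMN: "phic K I M x \<in> domc K M N" and zMN: "phic K L M z \<in> domc K M N"
    using phic_image_domc[OF I M N sub(4,5)] phic_image_domc[OF L M N sub(3,5)] xN a by blast+
  have "phic K M N (phic K I M x) = phic K M N (phic K L M z)"
    using phic_cocycle(2)[OF I M N sub(4,5) xM xMN] phic_cocycle(2)[OF L M N sub(3,5) zM zMN] eq a
    by simp
  then have "phic K I M x = phic K L M z"
    using inj_on_phic[OF M N sub(5)] xMN zMN by (meson inj_onD)
  then show ?thesis
    using I L M xM zM unfolding common_image_def M_def by simp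
qed

text \<open>The property is propagated along a chain of identifications. The assumptions on
  \<open>p\<close> serve the base case, as the reflexive closure also contains pairs outside the
  disjoint union of the domains.\<close>

lemma kur_rel_imp_common_image:
  assumes "(p, q) \<in> kur_rel K" and "fst p \<in> kIK K" "snd p \<in> topspace (UT K (fst p))"
  shows "common_image p q"
  using assms(1) unfolding kur_rel_def
proof (induction rule: rtrancl_induct)
  case base
  then show ?case
    using assms(2,3) unfolding common_image_def by (simp add: domc_def)
next
  case (step q s)
  obtain I x where p: "p = (I, x)" by fastforce
  from step.hyps(2) show ?case
  proof
    assume "(q, s) \<in> kur_step K"
    then obtain J L y where "q = (J, y)" "s = (L, phic K J L y)" "L \<in> kIK K" "J \<subseteq> L" "y \<in> domc K J L"
      unfolding kur_step_def by blast
    then show ?case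
      using common_image_step_up step.IH p by blast
  next
    assume "(q, s) \<in> (kur_step K)\<inverse>"
    then obtain J L z where "s = (L, z)" "q = (J, phic K L J z)" "L \<in> kIK K" "L \<subseteq> J" "z \<in> domc K L J"
      unfolding kur_step_def by blast
    then show ?case
      using common_image_step_down step.IH p by blast
  qed
qed

text \<open>For nested indices the comparison chart is the larger chart itself, where the second
  point is mapped by the identity.\<close>

lemma kur_rel_nested:
  assumes "((I, x), (J, y)) \<in> kur_rel K" "I \<in> kIK K" "x \<in> topspace (UT K I)" "I \<subseteq> J"
  shows "x \<in> domc K I J" "phic K I J x = y"
  using kur_rel_imp_common_image[OF assms(1)] assms(2-4)
  unfolding common_image_def by (auto simp: Un_absorb1 phic_def)

lemma closedin_phic_graph:
  assumes "I \<in> kIK K" "J \<in> kIK K" "I \<subseteq> J"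
  shows "closedin (prod_topology (UT K I) (UT K J)) {(x, y). x \<in> domc K I J \<and> phic K I J x = y}"
  using closedin_embedding_map_graph[OF embedding_map_phic[OF assms] domc_subset[OF assms(1,2,3)] _
      closedin_phic_image[OF assms]] chart[OF assms(1)] metrizable_imp_Hausdorff_space
  unfolding kur_chart_def by blast

end

section \<open>Closedness of the identifications between nested charts\<close>

lemma sym_kur_rel: "sym (kur_rel K)"
  unfolding kur_rel_def by (intro sym_rtrancl) (auto simp: sym_def)

lemma equiv_Z_rel: "equiv UNIV (Z_rel K V \<sigma>)"
  unfolding Z_rel_def Let_def
  by (intro equivI refl_rtrancl sym_rtrancl trans_rtrancl) (auto simp: sym_def)

lemma Z_rel_subset_kur_rel: "Z_rel K V \<sigma> \<subseteq> kur_rel K"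
  unfolding Z_rel_def Let_def kur_rel_def by (intro rtrancl_mono) auto

lemma kur_step_imp_Z_rel:
  assumes "(p, q) \<in> kur_step K" "p \<in> Zset K V \<sigma>" "q \<in> Zset K V \<sigma>"
  shows "(p, q) \<in> Z_rel K V \<sigma>"
  unfolding Z_rel_def Let_def using assms by blast

context tame_kuranishi
begin

text \<open>Over nested index pairs the relation consists of graphs of coordinate changes and their
  transposes. There is one closed graph per block, so the union is closed in the product of the
  sums.\<close>

lemma closed_kur_rel_on_nested:
  assumes nested: "\<And>I x J y. (I, x) \<in> Z \<Longrightarrow> (J, y) \<in> Z \<Longrightarrow> ((I, x), (J, y)) \<in> kur_rel K \<Longrightarrow>
      I \<subseteq> J \<or> J \<subseteq> I"
    and Z: "Z \<subseteq> topspace (kur_sum K)"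
  shows "closedin (prod_topology (subtopology (kur_sum K) Z) (subtopology (kur_sum K) Z))
      (kur_rel K \<inter> (Z \<times> Z))"
proof -
  define D where "D = {((I, x), (J, y)) | I x J y. I \<in> kIK K \<and> J \<in> kIK K \<and> I \<subseteq> J \<and>
      x \<in> domc K I J \<and> phic K I J x = y}"
  have top: "topspace (kur_sum K) = Sigma (kIK K) (topspace \<circ> UT K)"
    unfolding kur_sum_def by simp
  have D: "closedin (prod_topology (kur_sum K) (kur_sum K)) D"
    unfolding kur_sum_def
  proof (rule closedin_prod_sum_topology)
    show "D \<subseteq> topspace (sum_topology (UT K) (kIK K)) \<times> topspace (sum_topology (UT K) (kIK K))"
      unfolding D_def using domc_subset phic_in_topspace by force
  next
    fix I J assume IJ: "I \<in> kIK K" "J \<in> kIK K"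
    show "closedin (prod_topology (UT K I) (UT K J)) {(x, y). ((I, x), (J, y)) \<in> D}"
    proof (cases "I \<subseteq> J")
      case True
      then show ?thesis
        using closedin_phic_graph[OF IJ True] IJ unfolding D_def by (simp add: eq_commute conj_commute)
    qed (simp add: D_def)
  qed
  have "homeomorphic_map (prod_topology (kur_sum K) (kur_sum K)) (prod_topology (kur_sum K) (kur_sum K)) prod.swap"
    using homeomorphic_map_swap[of "kur_sum K" "kur_sum K"]
    by (simp add: case_prod_unfold prod.swap_def[abs_def])
  then have "closedin (prod_topology (kur_sum K) (kur_sum K)) (prod.swap ` D)"
    using D homeomorphic_imp_closed_map closed_map_def by blast
  then have cl: "closedin (prod_topology (kur_sum K) (kur_sum K)) (D \<union> prod.swap ` D)"
    using D by blast
  have DK: "D \<subseteq> kur_rel K"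
    unfolding D_def kur_rel_def kur_step_def by blast
  \<comment> \<open>The inclusion into \<open>kur_rel\<close> holds everywhere; the converse needs
    the restriction to \<open>Z\<close>, where related points have nested indices.\<close>
  have "kur_rel K \<inter> (Z \<times> Z) = (D \<union> prod.swap ` D) \<inter> (Z \<times> Z)"
  proof
    show "kur_rel K \<inter> (Z \<times> Z) \<subseteq> (D \<union> prod.swap ` D) \<inter> (Z \<times> Z)"
    proof clarify
      fix I x J y assume r: "((I, x), (J, y)) \<in> kur_rel K" and p: "(I, x) \<in> Z" and q: "(J, y) \<in> Z"
      have r': "((J, y), (I, x)) \<in> kur_rel K"
        using r sym_kur_rel by (meson symD)
      have I: "I \<in> kIK K" "x \<in> topspace (UT K I)" and J: "J \<in> kIK K" "y \<in> topspace (UT K J)"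
        using p q Z top by auto
      consider "I \<subseteq> J" | "J \<subseteq> I"
        using nested p q r by blast
      then have "((I, x), (J, y)) \<in> D \<or> ((J, y), (I, x)) \<in> D"
      proof cases
        case 1
        then show ?thesis
          using kur_rel_nested[OF r I 1] I J unfolding D_def by simp
      next
        case 2
        then show ?thesis
          using kur_rel_nested[OF r' J 2] I J unfolding D_def by simp
      qed
      then show "((I, x), (J, y)) \<in> (D \<union> prod.swap ` D) \<inter> (Z \<times> Z)"
        using p q by force
    qed
    show "(D \<union> prod.swap ` D) \<inter> (Z \<times> Z) \<subseteq> kur_rel K \<inter> (Z \<times> Z)"
    proof -
      have "prod.swap p \<in> kur_rel K" if "p \<in> D" for p
        using DK that symD[OF sym_kur_rel, of "fst p" "snd p" K] by (cases p) auto
      then show ?thesis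
        using DK by blast
    qed
  qed
  then have "closedin (subtopology (prod_topology (kur_sum K) (kur_sum K)) (Z \<times> Z)) (kur_rel K \<inter> (Z \<times> Z))"
    using cl by (auto simp: closedin_subtopology)
  then show ?thesis
    by (simp add: subtopology_Times)
qed

end

section \<open>The zero set of a compatible family of sections\<close>

theorem mainTheorem18:
  fixes X :: "'x topology" and K :: "('x, 'u, 'e) kur_data"
    and V C :: "nat set \<Rightarrow> 'u set" and \<sigma> :: "nat set \<Rightarrow> 'u \<Rightarrow> 'e"
  assumes "compact_space X" and "metrizable_space X"
    and "tame_kur_atlas X K"
    and "nested_reduction K C V"
    and "\<forall>I \<in> kIK K. continuous_map (subtopology (UT K I) (V I)) (ET K I) (\<sigma> I)"
    and "\<forall>I \<in> kIK K. \<forall>x \<in> V I. prj K I (\<sigma> I x) = x"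
    and "\<forall>I \<in> kIK K. \<forall>J \<in> kIK K. I \<subset> J \<longrightarrow>
           (\<forall>x \<in> V I \<inter> dom K I J. phi K I J x \<in> V J \<longrightarrow>
              Phi K I J (\<sigma> I x) = \<sigma> J (phi K I J x))"
    and "\<forall>I \<in> kIK K. \<forall>x \<in> V I. \<sigma> I x = zr K I x \<longrightarrow>
           (\<exists>J \<in> kIK K. \<exists>y \<in> C J. ((I, x), (J, y)) \<in> kur_rel K)"
  shows "Hausdorff_space (Z_quot K V \<sigma>) \<and> seq_compact_space (Z_quot K V \<sigma>)"
proof -
  interpret tame_kuranishi X K
    by unfold_locales (rule assms(3))
  define Z where "Z = Zset K V \<sigma>"
  define r where "r = Z_rel K V \<sigma>"
  define T where "T = subtopology (kur_sum K) Z"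
  have redV: "reduction K V"
    and nestC: "\<And>I. I \<in> kIK K \<Longrightarrow> C I \<subseteq> V I \<and>
        compactin (subtopology (UT K I) (V I)) (subtopology (UT K I) (V I) closure_of C I)"
    using assms(4) unfolding nested_reduction_def by auto
  have VU: "V I \<subseteq> topspace (UT K I)" if "I \<in> kIK K" for I
    using redV that unfolding reduction_def by (simp add: openin_subset)
  have met: "metrizable_space (UT K I)" "metrizable_space (ET K I)" if "I \<in> kIK K" for I
    using chart[OF that] unfolding kur_chart_def by auto
  have Zsub: "Z \<subseteq> topspace (kur_sum K)"
    unfolding Z_def Zset_def kur_sum_def using subsetD[OF VU] by auto
  then have topT: "topspace T = Z"
    unfolding T_def by (simp add: inf.absorb2)
  have nestedV: "I \<subseteq> J \<or> J \<subseteq> I"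
    if "I \<in> kIK K" "J \<in> kIK K" "x \<in> V I" "y \<in> V J" "((I, x), (J, y)) \<in> kur_rel K" for I J x y
  proof -
    have "x \<in> UT K I closure_of V I" "y \<in> UT K J closure_of V J"
      using that(3,4) closure_of_subset[OF VU[OF that(1)]] closure_of_subset[OF VU[OF that(2)]] by auto
    then show ?thesis
      using redV that unfolding reduction_def by blast
  qed
  \<comment> \<open>\<open>Z_rel\<close> only allows chains that stay in \<open>Z\<close>, whereas
    \<open>kur_rel\<close> may leave it. They agree on \<open>Z\<close> because the reduction forces
    nested indices, and then a single step, forward or backward, joins the two points.\<close>
  have rel: "(p, q) \<in> r \<longleftrightarrow> (p, q) \<in> kur_rel K" if p: "p \<in> Z" and q: "q \<in> Z" for p q
  proof
    assume "(p, q) \<in> r"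
    then show "(p, q) \<in> kur_rel K"
      using Z_rel_subset_kur_rel unfolding r_def by blast
  next
    assume k: "(p, q) \<in> kur_rel K"
    obtain I x J y where pq: "p = (I, x)" "q = (J, y)" by fastforce
    have I: "I \<in> kIK K" "x \<in> V I" and J: "J \<in> kIK K" "y \<in> V J"
      using p q pq unfolding Z_def Zset_def by auto
    have k': "((J, y), (I, x)) \<in> kur_rel K"
      using k sym_kur_rel pq by (meson symD)
    consider "I \<subseteq> J" | "J \<subseteq> I"
      using nestedV I J k pq by blast
    then show "(p, q) \<in> r"
    proof cases
      case 1
      then have "(p, q) \<in> kur_step K"
        using kur_rel_nested[of I x J y] k pq I J VU unfolding kur_step_def by blast
      then show ?thesis
        using kur_step_imp_Z_rel p q unfolding r_def Z_def by blast
    next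
      case 2
      then have "(q, p) \<in> kur_step K"
        using kur_rel_nested[of J y I x] k' pq I J VU unfolding kur_step_def by blast
      then show ?thesis
        using kur_step_imp_Z_rel p q equiv_Z_rel unfolding r_def Z_def by (metis equivE symD)
    qed
  qed
  have closed: "closedin (prod_topology T T) (r \<inter> (topspace T \<times> topspace T))"
  proof -
    have "r \<inter> (Z \<times> Z) = kur_rel K \<inter> (Z \<times> Z)"
      using rel by auto
    moreover have "closedin (prod_topology T T) (kur_rel K \<inter> (Z \<times> Z))"
      unfolding T_def
    proof (rule closed_kur_rel_on_nested[OF _ Zsub])
      fix I x J y assume "(I, x) \<in> Z" "(J, y) \<in> Z" "((I, x), (J, y)) \<in> kur_rel K"
      then show "I \<subseteq> J \<or> J \<subseteq> I"
        using nestedV[of I J x y] unfolding Z_def Zset_def by auto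
    qed
    ultimately show ?thesis
      unfolding topT by simp
  qed
  \<comment> \<open>The closure of \<open>C J\<close> is taken inside \<open>V J\<close>, where
    nestedness makes it compact and \<open>\<sigma> J\<close> is continuous. The zeros of
    \<open>\<sigma> J\<close> are relatively closed in \<open>V J\<close>, so their intersection
    with this closure is compact.\<close>
  define Q where "Q J = (subtopology (UT K J) (V J) closure_of C J) \<inter>
      {y \<in> topspace (subtopology (UT K J) (V J)). \<sigma> J y = zr K J y}" for J
  have compQ: "compactin (UT K J) (Q J)" if J: "J \<in> kIK K" for J
  proof -
    have "continuous_map (subtopology (UT K J) (V J)) (ET K J) (zr K J)"
      using chart[OF J] continuous_map_from_subtopology unfolding kur_chart_def by blast
    then have "closedin (subtopology (UT K J) (V J))
        {y \<in> topspace (subtopology (UT K J) (V J)). \<sigma> J y = zr K J y}"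
      using closedin_continuous_maps_eq metrizable_imp_Hausdorff_space met(2)[OF J] assms(5) J by blast
    then have "compactin (subtopology (UT K J) (V J)) (Q J)"
      unfolding Q_def using nestC[OF J] compact_Int_closedin by blast
    then show ?thesis
      by (simp add: compactin_subtopology)
  qed
  have QZ: "Sigma (kIK K) Q \<subseteq> Z"
    unfolding Q_def Z_def Zset_def by auto
  have compT: "compactin T (Sigma (kIK K) Q)"
  proof -
    have "compactin (kur_sum K) (Pair J ` Q J)" if "J \<in> kIK K" for J
      unfolding kur_sum_def
      using compQ[OF that] continuous_map_component_injection[OF that] image_compactin by blast
    then have "compactin (kur_sum K) (\<Union>J\<in>kIK K. Pair J ` Q J)"
      using finite_kIK by (intro compactin_Union) auto
    moreover have "(\<Union>J\<in>kIK K. Pair J ` Q J) = Sigma (kIK K) Q"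
      by auto
    ultimately show ?thesis
      using QZ unfolding T_def by (simp add: compactin_subtopology)
  qed
  have meets: "\<exists>q\<in>Sigma (kIK K) Q. (p, q) \<in> r" if p: "p \<in> topspace T" for p
  proof -
    obtain I x where pI: "p = (I, x)" and I: "I \<in> kIK K" "x \<in> V I" "\<sigma> I x = zr K I x"
      using p unfolding topT Z_def Zset_def by blast
    \<comment> \<open>The support condition on zeros supplies a related point \<open>y\<close> in
      \<open>C J\<close>; what remains is that \<open>y\<close> is itself a zero of
      \<open>\<sigma> J\<close>.\<close>
    obtain J y where J: "J \<in> kIK K" "y \<in> C J" and k: "((I, x), (J, y)) \<in> kur_rel K"
      using assms(8) I by blast
    have yV: "y \<in> V J"
      using nestC J by blast
    have xU: "x \<in> topspace (UT K I)" and yU: "y \<in> topspace (UT K J)"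
      using VU I J yV by auto
    consider (eq) "I = J" | (up) "I \<subset> J" | (down) "J \<subset> I"
      using nestedV[OF I(1) J(1) I(2) yV k] by blast
    then have sy: "\<sigma> J y = zr K J y"
    proof cases
      case eq
      then show ?thesis
        using kur_rel_nested(2)[OF k I(1) xU] I by (auto simp: phic_def)
    next
      case up
      then have x: "x \<in> dom K I J" "phi K I J x = y"
        using kur_rel_nested[OF k I(1) xU] by (auto simp: phic_def domc_def split: if_splits)
      \<comment> \<open>Going up, the coordinate change carries both the section and the zero
        section forward, so a zero is mapped to a zero.\<close>
      have "Phi K I J (\<sigma> I x) = \<sigma> J (phi K I J x)"
        using assms(7)[rule_format, OF I(1) J(1) up, of x] I(2) x yV by simp
      moreover have "zr K J (phi K I J x) = Phi K I J (zr K I x)"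
        using change[OF I(1) J(1) up] x(1) unfolding coord_change_def by simp
      ultimately show ?thesis
        using I(3) x(2) by simp
    next
      case down
      have "((J, y), (I, x)) \<in> kur_rel K"
        using k sym_kur_rel by (meson symD)
      then have y: "y \<in> dom K J I" "phi K J I y = x"
        using kur_rel_nested[OF _ J(1) yU, of I x] down by (auto simp: phic_def domc_def split: if_splits)
      \<comment> \<open>Going down, \<open>\<sigma> J y\<close> and the zero over \<open>y\<close>
        have the same image under \<open>Phi K J I\<close>. Both lie over a point of the domain of
        the coordinate change, where this map is injective.\<close>
      have eq1: "Phi K J I (\<sigma> J y) = Phi K J I (zr K J y)"
      proof -
        have "Phi K J I (\<sigma> J y) = \<sigma> I (phi K J I y)"
          using assms(7)[rule_format, OF J(1) I(1) down, of y] I(2) y yV by simp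
        moreover have "zr K I (phi K J I y) = Phi K J I (zr K J y)"
          using change[OF J(1) I(1) down] y(1) unfolding coord_change_def by simp
        ultimately show ?thesis
          using I(3) y(2) by simp
      qed
      define S where "S = {e \<in> topspace (ET K J). prj K J e \<in> dom K J I}"
      have "embedding_map (subtopology (ET K J) S) (ET K I) (Phi K J I)"
        using change[OF J(1) I(1) down] unfolding coord_change_def S_def by blast
      then have "inj_on (Phi K J I) (topspace (subtopology (ET K J) S))"
        unfolding embedding_map_def by (rule homeomorphic_imp_injective_map)
      moreover have "topspace (subtopology (ET K J) S) = S"
        unfolding S_def by auto
      ultimately have inj: "inj_on (Phi K J I) S"
        by simp
      have "continuous_map (subtopology (UT K J) (V J)) (ET K J) (\<sigma> J)"
        using assms(5) J by blast
      then have "\<sigma> J y \<in> topspace (ET K J)"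
        by (rule continuous_map_in_topspace) (use yU yV in simp)
      then have "\<sigma> J y \<in> S"
        using assms(6) J yV y unfolding S_def by simp
      moreover have "zr K J y \<in> S"
      proof -
        have "continuous_map (UT K J) (ET K J) (zr K J)" "prj K J (zr K J y) = y"
          using chart[OF J(1)] yU unfolding kur_chart_def by blast+
        then show ?thesis
          using continuous_map_in_topspace[OF _ yU] y(1) unfolding S_def by simp
      qed
      ultimately show ?thesis
        using inj eq1 by (meson inj_onD)
    qed
    have "y \<in> subtopology (UT K J) (V J) closure_of C J"
      using J nestC yV yU
      by (metis (no_types, lifting) VU closure_of_subset inf.absorb2 subsetD topspace_subtopology)
    then have "(J, y) \<in> Sigma (kIK K) Q"
      using J sy yV yU unfolding Q_def by simp
    then show ?thesis
      using rel[of p "(J, y)"] QZ k pI p topT by blast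
  qed
  have "Hausdorff_space T"
    unfolding T_def kur_sum_def
    by (intro Hausdorff_space_subtopology Hausdorff_space_sum_topology metrizable_imp_Hausdorff_space met(1))
  then have haus: "Hausdorff_space (quot_topology T r)"
    using Hausdorff_space_quot_topology[OF _ closed _ compT meets] equiv_Z_rel unfolding r_def by blast
  have "seq_compact_space (quot_topology T r)"
  proof (rule seq_compact_space_quot_topology[OF _ _ _ meets])
    show "equiv UNIV r"
      unfolding r_def by (rule equiv_Z_rel)
    show "Sigma (kIK K) Q \<subseteq> topspace T"
      using QZ topT by simp
    fix f :: "nat \<Rightarrow> nat set \<times> 'u" assume f: "range f \<subseteq> Sigma (kIK K) Q"
    obtain l and k :: "nat \<Rightarrow> nat" where l: "l \<in> Sigma (kIK K) Q" "strict_mono k"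
      "limitin (kur_sum K) (f \<circ> k) l sequentially"
      unfolding kur_sum_def
      by (rule sum_topology_subsequence[where X = "UT K", OF finite_kIK met(1) compQ f])
    moreover have "\<And>n. (f \<circ> k) n \<in> Z"
      using subset_trans[OF f QZ] by (simp add: image_subset_iff)
    \<comment> \<open>The terms and the limit all lie in \<open>Z\<close>, so convergence in the
      disjoint union of the domains is convergence in \<open>T\<close>.\<close>
    ultimately have "limitin T (f \<circ> k) l sequentially"
      unfolding T_def limitin_subtopology using subsetD[OF QZ] by simp
    then show "\<exists>l\<in>Sigma (kIK K) Q. \<exists>k::nat\<Rightarrow>nat. strict_mono k \<and> limitin T (f \<circ> k) l sequentially"
      using l by blast
  qed
  with haus show ?thesis
    unfolding Z_quot_def T_def Z_def r_def by blast
qed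

end
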